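(* Let $H \in \mathbb{R}^{K \times K}$ be a matrix and let $\mu := \max_{i,j} |H_{ij}|$ be its maximal absolute entry. Assume that the random support $I \subseteq \{1,\dots,K\}$ is chosen according to the rejective sampling model with probabilities $p_1, \dots, p_K$ such that $\sum_{i=1}^K p_i = S$; denote by $\mathbb{P}_S$ the corresponding probability measure. Let $W = \operatorname{diag}(\sqrt{p_1},\dots,\sqrt{p_K})$ be the corresponding weight matrix. Then, for all $v > 0$, \[ \mathbb{P}_S\big( \| H_I \|_{\infty,2} \geq v \big) \leq 2K \left( e\, \frac{\|HW\|_{\infty,2}^2}{v^2} \right)^{\frac{v^2}{\mu^2}}. \]
   Context: $\|A\|_{\infty,2} := \max_{\|x\|_2=1}\|Ax\|_\infty$ is the maximal $\ell_2$-norm of a row of $A$. $H_I$ is the submatrix of $H$ consisting of the columns indexed by $I$ (all rows kept). Poisson sampling model: let $p_1,\dots,p_K \in [0,1]$ with $\sum_{j} p_j = S$, $S$ a positive integer, and let $\delta_1,\dots,\delta_K$ be independent Bernoulli $0$-$1$ random variables with $\mathbb{E}\,\delta_j = p_j$; the random support is $\{i : \delta_i = 1\}$, so $\mathbb{P}(I) = \prod_{i\in I} p_i \prod_{j \notin I}(1-p_j)$ for $I \subseteq \{1,\dots,K\}$. Rejective sampling model: the support $I$ is drawn from the Poisson sampling model conditioned on $|I| = S$, i.e. $\mathbb{P}_S(I) := \mathbb{P}(I \mid |I| = S)$. *)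

theory Defs
  imports "HOL-Probability.Probability" "Jordan_Normal_Form.DL_Submatrix"
begin

unbundle no vec_syntax
hide_const (open) Finite_Cartesian_Product.mat Finite_Cartesian_Product.vec

(* Vectors and matrices are those of Jordan_Normal_Form.Matrix, whose dimensions are ordinary
   natural numbers; the index set {1..K} of the mathematics is therefore {..<K} throughout. *)

definition vec_l2_norm :: "real Matrix.vec \<Rightarrow> real" where
  "vec_l2_norm x = L2_set (\<lambda>i. x $ i) {..<dim_vec x}"

definition vec_linf_norm :: "real Matrix.vec \<Rightarrow> real" where
  "vec_linf_norm x = Max ((\<lambda>i. \<bar>x $ i\<bar>) ` {..<dim_vec x})"

(* The operator norm from l2 to l-infinity. The maximum over the unit sphere is written as a
   supremum; it is attained, and for a matrix with at least one row and one column it is the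
   largest l2 norm of a row, see norm_inf_2_eq_Max_row below. *)
definition norm_inf_2 :: "real Matrix.mat \<Rightarrow> real" where
  "norm_inf_2 A =
     (SUP x \<in> {x \<in> carrier_vec (dim_col A). vec_l2_norm x = 1}. vec_linf_norm (A *\<^sub>v x))"

definition max_abs_entry :: "real Matrix.mat \<Rightarrow> real" where
  "max_abs_entry A = Max (abs ` elements_mat A)"

definition column_submatrix :: "'a Matrix.mat \<Rightarrow> nat set \<Rightarrow> 'a Matrix.mat" where
  "column_submatrix A I = submatrix A UNIV I"

definition weight_matrix :: "nat \<Rightarrow> (nat \<Rightarrow> real) \<Rightarrow> real Matrix.mat" where
  "weight_matrix K p = Matrix.mat K K (\<lambda>(i, j). if i = j then sqrt (p i) else 0)"

definition poisson_sampling :: "nat \<Rightarrow> (nat \<Rightarrow> real) \<Rightarrow> nat set pmf" where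
  "poisson_sampling K p =
     map_pmf (\<lambda>\<delta>. {i \<in> {..<K}. \<delta> i}) (Pi_pmf {..<K} False (\<lambda>i. bernoulli_pmf (p i)))"

(* cond_pmf is meaningful only when the conditioning event has positive probability; for
   probabilities with sum S this is rejective_sampling_well_defined below. *)
definition rejective_sampling :: "nat \<Rightarrow> nat \<Rightarrow> (nat \<Rightarrow> real) \<Rightarrow> nat set pmf" where
  "rejective_sampling K S p = cond_pmf (poisson_sampling K p) {I. card I = S}"

lemma pmf_poisson_sampling:
  assumes p: "\<And>i. i < K \<Longrightarrow> 0 \<le> p i \<and> p i \<le> 1" and I: "I \<subseteq> {..<K}"
  shows "pmf (poisson_sampling K p) I = (\<Prod>i\<in>I. p i) * (\<Prod>j\<in>{..<K} - I. 1 - p j)"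
proof -
  let ?P = "Pi_pmf {..<K} False (\<lambda>i. bernoulli_pmf (p i))"
  have "pmf (poisson_sampling K p) I = measure ?P ((\<lambda>\<delta>. {i \<in> {..<K}. \<delta> i}) -` {I})"
    unfolding poisson_sampling_def by (simp add: pmf_map)
  also have "\<dots> = measure ?P {\<lambda>i. i \<in> I}"
  proof (rule measure_prob_cong_0)
    fix \<delta> assume d: "\<delta> \<in> (\<lambda>\<delta>. {i \<in> {..<K}. \<delta> i}) -` {I} - {\<lambda>i. i \<in> I}"
    then have "\<exists>i. i \<notin> {..<K} \<and> \<delta> i" by (auto simp: fun_eq_iff)
    then show "pmf ?P \<delta> = 0" by (intro pmf_Pi_outside) auto
  qed (use I in auto)
  also have "\<dots> = pmf ?P (\<lambda>i. i \<in> I)" by (simp add: pmf.rep_eq)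
  also have "\<dots> = (\<Prod>i<K. pmf (bernoulli_pmf (p i)) (i \<in> I))"
    using I by (intro pmf_Pi') auto
  also have "\<dots> = (\<Prod>i<K. if i \<in> I then p i else 1 - p i)"
    using p by (intro prod.cong) auto
  also have "\<dots> = (\<Prod>i\<in>I. p i) * (\<Prod>j\<in>{..<K} - I. 1 - p j)"
    using I by (simp add: prod.If_cases Int_absorb1 Diff_eq)
  finally show ?thesis .
qed

lemma rejective_sampling_well_defined:
  assumes p: "\<And>i. i < K \<Longrightarrow> 0 \<le> p i \<and> p i \<le> 1" and S: "(\<Sum>i<K. p i) = real S"
  shows "set_pmf (poisson_sampling K p) \<inter> {I. card I = S} \<noteq> {}"
proof -
  define A where "A = {i \<in> {..<K}. p i = 1}"
  define B where "B = {i \<in> {..<K}. p i > 0}"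
  have fin: "finite A" "finite B" and AB: "A \<subseteq> B" and B: "B \<subseteq> {..<K}"
    by (auto simp: A_def B_def)
  have "real (card A) = (\<Sum>i\<in>A. p i)" by (simp add: A_def)
  also have "\<dots> \<le> (\<Sum>i<K. p i)" using p by (intro sum_mono2) (auto simp: A_def)
  finally have "card A \<le> S" using S by simp
  have "(\<Sum>i<K. p i) = (\<Sum>i\<in>B. p i)"
    using p by (intro sum.mono_neutral_right) (auto simp: B_def not_less intro: antisym)
  also have "\<dots> \<le> (\<Sum>i\<in>B. 1)" using p by (intro sum_mono) (auto simp: B_def)
  finally have "S \<le> card B" using S by simp
  obtain I where I: "A \<subseteq> I" "I \<subseteq> B" "card I = S"
    using exists_subset_between[OF \<open>card A \<le> S\<close> \<open>S \<le> card B\<close> AB fin(2)] by auto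
  have "finite I" using I(2) fin(2) finite_subset by auto
  have "pmf (poisson_sampling K p) I = (\<Prod>i\<in>I. p i) * (\<Prod>j\<in>{..<K} - I. 1 - p j)"
    using p I(2) B by (intro pmf_poisson_sampling) auto
  moreover have "(\<Prod>i\<in>I. p i) \<noteq> 0"
    using I \<open>finite I\<close> by (auto simp: B_def)
  moreover have "(\<Prod>j\<in>{..<K} - I. 1 - p j) \<noteq> 0"
    using I by (auto simp: A_def)
  ultimately have "I \<in> set_pmf (poisson_sampling K p)" by (simp add: set_pmf_iff)
  then show ?thesis using I(3) by auto
qed

lemma norm_inf_2_eq_Max_row:
  assumes r: "dim_row A > 0" and c: "dim_col A > 0"
  shows "norm_inf_2 A = Max ((\<lambda>i. vec_l2_norm (Matrix.row A i)) ` {..<dim_row A})"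
proof -
  let ?U = "{x \<in> carrier_vec (dim_col A). vec_l2_norm x = 1}"
  let ?R = "\<lambda>i. vec_l2_norm (Matrix.row A i)"
  let ?M = "Max (?R ` {..<dim_row A})"
  have entry: "(A *\<^sub>v x) $ i = (\<Sum>j<dim_col A. A $$ (i, j) * x $ j)"
    if "x \<in> carrier_vec (dim_col A)" "i < dim_row A" for x i
    using that by (simp add: scalar_prod_def atLeast0LessThan)
  have norms: "vec_l2_norm x = L2_set (\<lambda>j. x $ j) {..<dim_col A}"
    if "x \<in> carrier_vec (dim_col A)" for x
    using that by (simp add: vec_l2_norm_def)
  have rows: "?R i = L2_set (\<lambda>j. A $$ (i, j)) {..<dim_col A}" if "i < dim_row A" for i
    using that unfolding vec_l2_norm_def by (intro L2_set_cong) auto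
  have ub: "vec_linf_norm (A *\<^sub>v x) \<le> ?M" if x: "x \<in> ?U" for x
  proof -
    have "\<bar>(A *\<^sub>v x) $ i\<bar> \<le> ?M" if i: "i < dim_row A" for i
    proof -
      have "\<bar>(A *\<^sub>v x) $ i\<bar> \<le> (\<Sum>j<dim_col A. \<bar>A $$ (i, j)\<bar> * \<bar>x $ j\<bar>)"
        using x i by (subst entry) (auto simp: sum_abs simp flip: abs_mult)
      also have "\<dots> \<le> L2_set (\<lambda>j. A $$ (i, j)) {..<dim_col A} * L2_set (\<lambda>j. x $ j) {..<dim_col A}"
        by (rule L2_set_mult_ineq)
      also have "\<dots> = ?R i"
        using x rows[OF i] norms[of x] by simp
      also have "\<dots> \<le> ?M" using i by auto
      finally show ?thesis .
    qed
    then show ?thesis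
      using r unfolding vec_linf_norm_def by (subst Max_le_iff) auto
  qed
  have "?M \<in> ?R ` {..<dim_row A}" using r by (intro Max_in) auto
  then obtain i where i: "i < dim_row A" "?M = ?R i" by auto
  have "\<exists>x \<in> ?U. ?M \<le> vec_linf_norm (A *\<^sub>v x)"
  proof -
    have "\<exists>x \<in> ?U. ?R i \<le> \<bar>(A *\<^sub>v x) $ i\<bar>"
    proof (cases "?R i = 0")
      case True
      have "vec_l2_norm (unit_vec (dim_col A) 0) = L2_set (\<lambda>j. if j = 0 then 1 else 0) {..<dim_col A}"
        unfolding vec_l2_norm_def by (intro L2_set_cong) auto
      also have "\<dots> = 1" using c by (simp add: L2_set_def if_distrib[of "\<lambda>a. a\<^sup>2"] cong: if_cong)
      finally have "unit_vec (dim_col A) 0 \<in> ?U" by simp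
      then show ?thesis using True by (intro bexI[of _ "unit_vec (dim_col A) 0"]) auto
    next
      case False
      define x where "x = Matrix.vec (dim_col A) (\<lambda>j. A $$ (i, j) / ?R i)"
      have Rpos: "?R i > 0" using False by (simp add: vec_l2_norm_def L2_set_nonneg less_le)
      have xc: "x \<in> carrier_vec (dim_col A)" by (simp add: x_def)
      have sq: "(\<Sum>j<dim_col A. (A $$ (i, j))\<^sup>2) = (?R i)\<^sup>2"
        using i by (simp add: rows L2_set_def sum_nonneg)
      have "(\<Sum>j<dim_col A. (x $ j)\<^sup>2) = (\<Sum>j<dim_col A. (A $$ (i, j))\<^sup>2) / (?R i)\<^sup>2"
        by (simp add: x_def power_divide sum_divide_distrib)
      also have "\<dots> = 1" using sq Rpos by simp
      finally have "vec_l2_norm x = 1" using xc by (simp add: norms L2_set_def)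
      moreover have "(A *\<^sub>v x) $ i = (\<Sum>j<dim_col A. (A $$ (i, j))\<^sup>2) / ?R i"
        using i xc unfolding entry[OF xc i(1)]
        by (simp add: x_def power2_eq_square sum_divide_distrib)
      then have "(A *\<^sub>v x) $ i = ?R i" using sq Rpos by (simp add: power2_eq_square)
      ultimately show ?thesis using xc by (intro bexI[of _ x]) auto
    qed
    then obtain x where x: "x \<in> ?U" "?R i \<le> \<bar>(A *\<^sub>v x) $ i\<bar>" by blast
    have "\<bar>(A *\<^sub>v x) $ i\<bar> \<le> vec_linf_norm (A *\<^sub>v x)"
      using i unfolding vec_linf_norm_def by (intro Max_ge) auto
    then show ?thesis using x i by force
  qed
  then obtain x where x: "x \<in> ?U" "?M \<le> vec_linf_norm (A *\<^sub>v x)" by blast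
  show ?thesis
  proof (rule antisym)
    show "norm_inf_2 A \<le> ?M"
      unfolding norm_inf_2_def using x(1) ub by (intro cSUP_least) auto
    have "bdd_above ((\<lambda>x. vec_linf_norm (A *\<^sub>v x)) ` ?U)"
      using ub by (intro bdd_aboveI2) auto
    from cSUP_upper[OF x(1) this] show "?M \<le> norm_inf_2 A"
      unfolding norm_inf_2_def using x(2) by linarith
  qed
qed

end

(* With a_k(x) the k-th coefficient of prod_j (1 - p_j + p_j x_j X), the expectation of
   prod_{j in I} x_j under rejective sampling is a_S(x) / a_S(1). A product of linear factors with
   nonnegative coefficients has log-concave coefficients, so for x >= 1 each ratio a_k(x) / a_S(x)
   with k >= S is at least its value at x = 1. Summing over k >= S gives
     a_S(x) / a_S(1) <= prod_j (1 - p_j + p_j x_j) / P(|I| >= S),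
   and P(|I| >= S) >= 1/2 because the integer mean S of a Poisson binomial variable is a median:
   this is reduced to the binomial case by Hoeffding's method of moving two of the p_j at
   constant sum. Rejective sampling thus loses only a factor 2 over independent sampling in the
   Chernoff bound, which is applied to the squared norm of each row of H_I. *)

theory Submission
  imports Defs
begin

section \<open>Log-concave coefficients of products of linear factors\<close>

text \<open>All pairs \<open>i \<le> j\<close> are compared, without division. Comparing consecutive
  triples only would admit internal zeros, as in 1 + X^3, and the monotonicity of coefficient ratios
  below fails for such polynomials.\<close>

definition log_concave_poly :: "real poly \<Rightarrow> bool" where
  "log_concave_poly q \<longleftrightarrow> (\<forall>i. 0 \<le> coeff q i) \<and>
     (\<forall>i j. i \<le> j \<longrightarrow> coeff q i * coeff q (Suc j) \<le> coeff q (Suc i) * coeff q j)"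

lemma coeff_linear_mult:
  fixes q :: "'a::comm_semiring_0 poly"
  shows "coeff ([:a, b:] * q) i = a * coeff q i + b * (if i = 0 then 0 else coeff q (i - 1))"
  by (cases i) (simp_all add: coeff_pCons)

text \<open>After expansion the two sides share one mixed \<open>a * b\<close> term, and each of the
  three other terms on the left is dominated by one on the right.\<close>

lemma log_concave_poly_linear_mult:
  assumes q: "log_concave_poly q" and ab: "0 \<le> a" "0 \<le> b"
  shows "log_concave_poly ([:a, b:] * q)"
proof -
  \<comment> \<open>\<open>c\<close> is the coefficient sequence of \<open>X * q\<close>, so that
    one formula for the coefficients of the product covers index 0 as well.\<close>
  define c where "c i = (if i = 0 then 0 else coeff q (i - 1))" for i
  have nn: "0 \<le> c i" for i using q by (auto simp: c_def log_concave_poly_def)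
  have Sc: "coeff q i = c (Suc i)" for i by (simp add: c_def)
  have lc: "c i * c (Suc j) \<le> c (Suc i) * c j" if "i \<le> j" for i j
    using that q nn by (cases i; cases j) (auto simp: c_def log_concave_poly_def)
  have eq: "coeff ([:a, b:] * q) i = a * c (Suc i) + b * c i" for i
    unfolding coeff_linear_mult by (simp add: c_def)
  show ?thesis unfolding log_concave_poly_def eq
  proof (intro conjI allI impI)
    fix i show "0 \<le> a * c (Suc i) + b * c i" using nn ab by simp
  next
    fix i j :: nat assume "i \<le> j"
    show "(a * c (Suc i) + b * c i) * (a * c (Suc (Suc j)) + b * c (Suc j))
        \<le> (a * c (Suc (Suc i)) + b * c (Suc i)) * (a * c (Suc j) + b * c j)"
    proof (cases "i = j")
      case True then show ?thesis by (simp add: mult.commute)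
    next
      case False
      with \<open>i \<le> j\<close> have ij: "i < j" by simp
      have 1: "c (Suc i) * c (Suc (Suc j)) \<le> c (Suc (Suc i)) * c (Suc j)" using lc ij by simp
      have 2: "c i * c (Suc j) \<le> c (Suc i) * c j" using lc ij by simp
      \<comment> \<open>The second half of this chain needs \<open>Suc i \<le> j\<close>, which is
        why \<open>i = j\<close> is treated apart.\<close>
      have "c i * c (Suc (Suc j)) \<le> c (Suc i) * c (Suc j)" using lc[of i "Suc j"] ij by simp
      also have "\<dots> \<le> c (Suc (Suc i)) * c j" using lc[of "Suc i" j] ij by simp
      finally have 3: "c i * c (Suc (Suc j)) \<le> c (Suc (Suc i)) * c j" .
      have "a\<^sup>2 * (c (Suc i) * c (Suc (Suc j))) + b\<^sup>2 * (c i * c (Suc j))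
            + a * b * (c i * c (Suc (Suc j)))
          \<le> a\<^sup>2 * (c (Suc (Suc i)) * c (Suc j)) + b\<^sup>2 * (c (Suc i) * c j)
            + a * b * (c (Suc (Suc i)) * c j)"
        using 1 2 3 ab by (intro add_mono mult_left_mono) auto
      then show ?thesis by (simp add: algebra_simps power2_eq_square)
    qed
  qed
qed

lemma log_concave_poly_prod_linear:
  assumes "\<And>j. j \<in> A \<Longrightarrow> 0 \<le> a j \<and> 0 \<le> b j"
  shows "log_concave_poly (\<Prod>j\<in>A. [:a j, b j:])"
  using assms
proof (induction A rule: infinite_finite_induct)
  case (insert j A)
  then show ?case by (simp add: log_concave_poly_linear_mult del: mult_pCons_left)
qed (auto simp: log_concave_poly_def)

text \<open>Taking the linear term exactly in the factors from \<open>I\<close> contributes to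
  degree \<open>card I\<close>. For \<open>a j = 1 - p j\<close> and \<open>b j = p j\<close> the
  coefficient is the probability that a Poisson support has \<open>k\<close> elements.\<close>

lemma coeff_prod_linear:
  fixes a b :: "'b \<Rightarrow> 'a::comm_semiring_1"
  assumes "finite A"
  shows "coeff (\<Prod>j\<in>A. [:a j, b j:]) k =
    (\<Sum>I | I \<subseteq> A \<and> card I = k. (\<Prod>j\<in>I. b j) * (\<Prod>j\<in>A - I. a j))"
proof -
  have "(\<Prod>j\<in>A. [:a j, b j:]) = (\<Prod>j\<in>A. monom (b j) 1 + monom (a j) 0)"
    by (intro prod.cong) (auto simp: monom_0 monom_Suc)
  also have "\<dots> = (\<Sum>I\<in>Pow A. (\<Prod>j\<in>I. monom (b j) 1) * (\<Prod>j\<in>A - I. monom (a j) 0))"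
    by (rule prod_add[OF assms])
  also have "\<dots> = (\<Sum>I\<in>Pow A. monom ((\<Prod>j\<in>I. b j) * (\<Prod>j\<in>A - I. a j)) (card I))"
  proof (intro sum.cong refl)
    fix I assume "I \<in> Pow A"
    have "finite B \<Longrightarrow> (\<Prod>j\<in>B. monom (f j) n) = monom (\<Prod>j\<in>B. f j) (n * card B)"
      for B n and f :: "'b \<Rightarrow> 'a"
      by (induction B rule: finite_induct) (auto simp: mult_monom algebra_simps)
    moreover have "finite I" "finite (A - I)" using assms \<open>I \<in> Pow A\<close> finite_subset by auto
    ultimately show "(\<Prod>j\<in>I. monom (b j) 1) * (\<Prod>j\<in>A - I. monom (a j) 0) =
        monom ((\<Prod>j\<in>I. b j) * (\<Prod>j\<in>A - I. a j)) (card I)"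
      by (simp add: mult_monom)
  qed
  finally have "coeff (\<Prod>j\<in>A. [:a j, b j:]) k =
      (\<Sum>I\<in>Pow A. if card I = k then (\<Prod>j\<in>I. b j) * (\<Prod>j\<in>A - I. a j) else 0)"
    by (simp add: coeff_sum)
  also have "\<dots> = (\<Sum>I | I \<subseteq> A \<and> card I = k. (\<Prod>j\<in>I. b j) * (\<Prod>j\<in>A - I. a j))"
    using assms by (subst sum.inter_filter[symmetric]) (auto simp: Pow_def)
  finally show ?thesis .
qed

section \<open>Monotonicity of coefficient ratios in the linear coefficients\<close>

text \<open>After cross-multiplication the two sides differ by
  \<open>a * (b' - b) * (c (Suc s) * c k - c s * c (Suc k))\<close>, with \<open>c\<close> the
  coefficients of \<open>X * q\<close>; log-concavity makes this nonnegative.\<close>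

lemma coeff_ratio_mono_one:
  assumes q: "log_concave_poly q" and a: "0 \<le> a" and b: "0 \<le> b" "b \<le> b'" and "s \<le> k"
    and pos: "coeff ([:a, b:] * q) s > 0"
  shows "coeff ([:a, b':] * q) s > 0"
    and "coeff ([:a, b:] * q) k / coeff ([:a, b:] * q) s
       \<le> coeff ([:a, b':] * q) k / coeff ([:a, b':] * q) s"
proof -
  define c where "c i = (if i = 0 then 0 else coeff q (i - 1))" for i
  have nn: "0 \<le> c i" for i using q by (auto simp: c_def log_concave_poly_def)
  have eq: "coeff ([:a, b:] * q) i = a * c (Suc i) + b * c i" for a b i
    unfolding coeff_linear_mult by (simp add: c_def)
  have lc: "c s * c (Suc k) \<le> c (Suc s) * c k"
    using q nn \<open>s \<le> k\<close> by (cases s; cases k) (auto simp: c_def log_concave_poly_def)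
  have "b * c s \<le> b' * c s" using nn b by (simp add: mult_right_mono)
  then show pos': "coeff ([:a, b':] * q) s > 0" using pos unfolding eq by linarith
  have "0 \<le> a * (b' - b) * (c (Suc s) * c k - c s * c (Suc k))" using a b lc by simp
  then have "coeff ([:a, b:] * q) k * coeff ([:a, b':] * q) s
      \<le> coeff ([:a, b':] * q) k * coeff ([:a, b:] * q) s"
    unfolding eq by (simp add: algebra_simps)
  then show "coeff ([:a, b:] * q) k / coeff ([:a, b:] * q) s
       \<le> coeff ([:a, b':] * q) k / coeff ([:a, b':] * q) s"
    using pos pos' by (simp add: divide_simps del: mult_pCons_left)
qed

text \<open>The factors are changed one at a time: \<open>R B\<close> has the new coefficients on
  \<open>B\<close> and the old ones elsewhere, and the product \<open>Q\<close> of all factors but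
  the one being changed is log-concave.\<close>

lemma coeff_ratio_mono:
  fixes a b b' :: "'a \<Rightarrow> real"
  assumes "finite A" and "\<And>j. j \<in> A \<Longrightarrow> 0 \<le> a j \<and> 0 \<le> b j \<and> b j \<le> b' j" and "s \<le> k"
    and "coeff (\<Prod>j\<in>A. [:a j, b j:]) s > 0"
  shows "coeff (\<Prod>j\<in>A. [:a j, b' j:]) s > 0 \<and>
    coeff (\<Prod>j\<in>A. [:a j, b j:]) k / coeff (\<Prod>j\<in>A. [:a j, b j:]) s
       \<le> coeff (\<Prod>j\<in>A. [:a j, b' j:]) k / coeff (\<Prod>j\<in>A. [:a j, b' j:]) s"
proof -
  define R where "R B = (\<Prod>j\<in>A. [:a j, if j \<in> B then b' j else b j:])" for B
  have "coeff (R B) s > 0 \<and> coeff (R {}) k / coeff (R {}) s \<le> coeff (R B) k / coeff (R B) s"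
    if "B \<subseteq> A" for B
    using finite_subset[OF that assms(1)] that
  proof (induction B rule: finite_induct)
    case empty then show ?case using assms(4) by (simp add: R_def)
  next
    case (insert i B)
    define Q where "Q = (\<Prod>j\<in>A - {i}. [:a j, if j \<in> B then b' j else b j:])"
    have i: "i \<in> A" using insert by auto
    have RB: "R B = [:a i, b i:] * Q" unfolding R_def Q_def
      by (subst prod.remove[OF assms(1) i]) (use insert in simp)
    have RiB: "R (insert i B) = [:a i, b' i:] * Q" unfolding R_def Q_def
      by (subst prod.remove[OF assms(1) i]) (auto intro!: arg_cong2[of _ _ _ _ "(*)"] prod.cong)
    have "log_concave_poly Q" unfolding Q_def
      using assms(2) by (intro log_concave_poly_prod_linear) (auto intro: order_trans)
    from coeff_ratio_mono_one[OF this _ _ _ assms(3), of "a i" "b i" "b' i"]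
    show ?case using insert assms(2)[OF i] unfolding RB RiB by fastforce
  qed
  moreover have "R A = (\<Prod>j\<in>A. [:a j, b' j:])" "R {} = (\<Prod>j\<in>A. [:a j, b j:])"
    by (simp_all add: R_def)
  ultimately show ?thesis by (metis order.refl)
qed

section \<open>The lower tail of a binomial variable at an integer mean\<close>

text \<open>With T_i = i * (n choose i) * x^(i-1) * (1-x)^(n-i), the i-th summand has derivative T_i
  - T_(i+1), so the sum telescopes to - T_k. Wherever a subtraction in an exponent is truncated, the
  coefficient in front is 0.\<close>

lemma binomial_head_has_derivative:
  fixes x :: real
  shows "((\<lambda>x. \<Sum>i<k. real (n choose i) * x ^ i * (1 - x) ^ (n - i)) has_real_derivative
     - (real (k * (n choose k)) * x ^ (k - 1) * (1 - x) ^ (n - k))) (at x)"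
proof (induction k)
  case (Suc k)
  have *: "real (Suc k * (n choose Suc k)) = real ((n - k) * (n choose k))"
    using binomial_absorb_comp[of n k] binomial_absorption[of k n] by (metis mult.commute)
  have "((\<lambda>x. real (n choose k) * x ^ k * (1 - x) ^ (n - k)) has_real_derivative
      real (k * (n choose k)) * x ^ (k - 1) * (1 - x) ^ (n - k)
      - real ((n - k) * (n choose k)) * x ^ k * (1 - x) ^ (n - Suc k)) (at x)"
    by (cases "k \<le> n") (auto intro!: derivative_eq_intros simp: of_nat_diff algebra_simps)
  from DERIV_add[OF Suc.IH this] show ?case
    unfolding * sum.lessThan_Suc diff_Suc_1 by (elim DERIV_cong) linarith
qed simp

text \<open>Times \<open>n\<close>, the left side is the logarithm of the quotient of the two sides
  of \<open>binomial_weight_comparison\<close>. It is 0 at \<open>r = 1\<close> and nonincreasing;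
  \<open>r < 1 / c\<close> keeps \<open>1 - c * r\<close> positive.\<close>

lemma binomial_log_comparison:
  fixes c r :: real
  assumes "0 < k" "k < n" "c = real k / real n" "1 \<le> r" "r < 1 / c"
  shows "2 * c * ln r + (1 - c) * (ln (1 - c * r) - ln (1 - c / r)) \<le> 0"
proof -
  have c: "0 < c" "c < 1" using assms by auto
  define F where "F r = 2 * c * ln r + (1 - c) * (ln (1 - c * r) - ln (1 - c / r))" for r
  have "F r \<le> F 1"
  proof (rule DERIV_nonpos_imp_nonincreasing[OF assms(4)], intro exI conjI)
    fix t assume t: "1 \<le> t" "t \<le> r"
    have ct: "c * t < 1" using t c assms(5) by (simp add: field_simps) (smt (verit) mult_left_mono)
    have ct': "c < t" using c t by simp
    define D where "D = 2 * c / t + (1 - c) * (- c / (1 - c * t) - (c / t\<^sup>2) / (1 - c / t))"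
    show "(F has_real_derivative D) (at t)"
      unfolding F_def D_def using c t ct ct'
      by (auto intro!: derivative_eq_intros simp: power2_eq_square)
    have "c / t\<^sup>2 / (1 - c / t) = c / t * (1 / (t - c))"
      using t ct' by (simp add: divide_simps power2_eq_square algebra_simps)
    moreover have "c / (1 - c * t) = c / t * (t / (1 - c * t))" using t by simp
    ultimately have "D = c / t * (2 - (1 - c) * (t / (1 - c * t) + 1 / (t - c)))"
      unfolding D_def by (simp only: minus_divide_left[symmetric]) (simp add: algebra_simps)
    also have "t / (1 - c * t) + 1 / (t - c) = (1 + t\<^sup>2 - 2 * c * t) / ((1 - c * t) * (t - c))"
      using t ct ct' by (simp add: add_frac_eq) (simp add: algebra_simps power2_eq_square)
    finally have D: "D = c / t * (2 - (1 - c) * ((1 + t\<^sup>2 - 2 * c * t) / ((1 - c * t) * (t - c))))"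
      by simp
    \<comment> \<open>The two sides differ by exactly
      \<open>(1 + c) * (1 - t)\<^sup>2\<close>.\<close>
    have "2 * ((1 - c * t) * (t - c)) \<le> (1 - c) * (1 + t\<^sup>2 - 2 * c * t)"
    proof -
      have "0 \<le> (1 + c) * (1 - t)\<^sup>2" using c by simp
      then show ?thesis by (simp add: algebra_simps power2_eq_square)
    qed
    then have "2 \<le> (1 - c) * ((1 + t\<^sup>2 - 2 * c * t) / ((1 - c * t) * (t - c)))"
      using ct ct' by (simp add: pos_le_divide_eq)
    then show "D \<le> 0" unfolding D using c t by (intro mult_nonneg_nonpos) auto
  qed
  then show ?thesis by (simp add: F_def)
qed

lemma binomial_weight_comparison:
  fixes c r :: real
  assumes "0 < k" "k < n" "c = real k / real n" "1 \<le> r" "r \<le> 1 / c"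
  shows "(c * r) ^ k * (1 - c * r) ^ (n - k) \<le> (c / r) ^ k * (1 - c / r) ^ (n - k)"
proof -
  have c: "0 < c" "c < 1" using assms by auto
  have cr': "c / r < 1" using c assms(4) by simp
  have cr0: "c / r > 0" using c assms by simp
  show ?thesis
  proof (cases "r = 1 / c")
    case True
    then have "c * r = 1" using c by simp
    then have "(1 - c * r) ^ (n - k) = 0" using assms(2) by simp
    then show ?thesis using cr' cr0 by (simp del: power_eq_0_iff)
  next
    case False
    then have r: "r < 1 / c" using assms by simp
    then have cr: "c * r < 1" using c by (simp add: field_simps)
    have crp: "c * r > 0" using c assms by simp
    have "n * c = k" "n * (1 - c) = n - k" using assms by (auto simp: field_simps of_nat_diff)
    then have eq: "n * (2 * c * ln r + (1 - c) * (ln (1 - c * r) - ln (1 - c / r)))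
       = 2 * k * ln r + real (n - k) * (ln (1 - c * r) - ln (1 - c / r))"
      by (simp add: ring_distribs(1) flip: mult.assoc)
    have "n * (2 * c * ln r + (1 - c) * (ln (1 - c * r) - ln (1 - c / r))) \<le> 0"
      using binomial_log_comparison[OF assms(1-4) r] by (simp add: mult_nonneg_nonpos)
    then have "2 * k * ln r + real (n - k) * (ln (1 - c * r) - ln (1 - c / r)) \<le> 0"
      unfolding eq .
    then have "ln ((c * r) ^ k * (1 - c * r) ^ (n - k)) \<le> ln ((c / r) ^ k * (1 - c / r) ^ (n - k))"
      using cr cr' crp cr0 c assms
      by (simp add: ln_mult ln_div ln_realpow) (simp add: algebra_simps)
    then show ?thesis using cr cr' crp cr0 by (subst (asm) ln_le_cancel_iff) auto
  qed
qed

lemma binomial_head_le_half: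
  assumes "0 < k" "k < n" "c = real k / real n"
  shows "(\<Sum>i<k. real (n choose i) * c ^ i * (1 - c) ^ (n - i)) \<le> 1 / 2"
proof -
  define G :: "real \<Rightarrow> real" where "G x = (\<Sum>i<k. real (n choose i) * x ^ i * (1 - x) ^ (n - i))" for x
  define C where "C = real (k * (n choose k))"
  have G': "(G has_real_derivative - (C * x ^ (k - 1) * (1 - x) ^ (n - k))) (at x)" for x
    unfolding G_def C_def by (rule binomial_head_has_derivative)
  have c: "0 < c" "c < 1" using assms by auto
  have "1 \<le> 1 / c" using c by simp
  \<comment> \<open>The function \<open>r \<mapsto> G (c * r) + G (c / r)\<close> increases on \<open>[1, 1 / c]\<close> from
    \<open>2 * G c\<close> to \<open>G 1 + G (c\<^sup>2) = G (c\<^sup>2) \<le> 1\<close>.\<close>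
  have "G (c * 1) + G (c / 1) \<le> G (c * (1 / c)) + G (c / (1 / c))"
  proof (rule DERIV_nonneg_imp_nondecreasing[OF \<open>1 \<le> 1 / c\<close>], intro exI conjI)
    fix r assume r: "1 \<le> r" "r \<le> 1 / c"
    have pw: "x ^ (k - 1) = x ^ k / x" if "x > 0" for x :: real
      using that assms(1) by (cases k) auto
    have crp: "c * r > 0" "c / r > 0" "r > 0" using c r by auto
    define D where "D = - (C * (c * r) ^ (k - 1) * (1 - c * r) ^ (n - k)) * c
        + - (C * (c / r) ^ (k - 1) * (1 - c / r) ^ (n - k)) * (- c / r\<^sup>2)"
    show "((\<lambda>r. G (c * r) + G (c / r)) has_real_derivative D) (at r)"
      unfolding D_def using crp
      by (auto intro!: derivative_eq_intros DERIV_chain2[OF G'] simp: field_simps power2_eq_square)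
    \<comment> \<open>Once \<open>x ^ (k - 1)\<close> is written as \<open>x ^ k / x\<close>, both
      summands carry the factor \<open>C / r\<close>, and the difference of the weights compared
      above remains.\<close>
    have "D = C / r * ((c / r) ^ k * (1 - c / r) ^ (n - k) - (c * r) ^ k * (1 - c * r) ^ (n - k))"
      unfolding D_def pw[OF crp(1)] pw[OF crp(2)] using crp c
      by (simp add: algebra_simps power2_eq_square)
    moreover have "0 \<le> C" by (simp add: C_def)
    ultimately show "0 \<le> D" using binomial_weight_comparison[OF assms r] crp by simp
  qed
  moreover have "G 1 = 0" unfolding G_def using assms by (intro sum.neutral) auto
  moreover have "G (c\<^sup>2) \<le> 1"
  proof -
    have "c\<^sup>2 \<le> 1" using c by (simp add: power_le_one)
    then have "G (c\<^sup>2) \<le> (\<Sum>i\<le>n. real (n choose i) * (c\<^sup>2) ^ i * (1 - c\<^sup>2) ^ (n - i))"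
      unfolding G_def using assms by (intro sum_mono2) auto
    also have "\<dots> = 1" using binomial_ring[of "c\<^sup>2" "1 - c\<^sup>2" n] by simp
    finally show ?thesis .
  qed
  ultimately have "G c \<le> 1 / 2" using c by (simp add: power2_eq_square)
  then show ?thesis by (simp add: G_def)
qed

section \<open>Hoeffding's reduction from the Poisson binomial to the binomial tail\<close>

text \<open>For a fixed sum \<open>x + y\<close> the product of two Bernoulli factors is affine in
  \<open>x * y\<close>; its slope is (1 - X)^2.\<close>

lemma bernoulli_pair_poly:
  fixes x y :: "'a::comm_ring_1"
  shows "[:1 - x, x:] * [:1 - y, y:] = [:1 - (x + y), x + y:] + Polynomial.smult (x * y) [:1, -2, 1:]"
  by (simp add: algebra_simps)

text \<open>The shift preserves \<open>p i + p j\<close> and all other factors, so the head changes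
  only through the product of the two values, with a slope \<open>C\<close> that is the same for
  every \<open>d\<close>.\<close>

lemma head_shift_pair:
  fixes p :: "'b \<Rightarrow> real"
  assumes "finite A" "i \<in> A" "j \<in> A" "i \<noteq> j"
  obtains C where "\<And>d. (\<Sum>k<s. coeff (\<Prod>l\<in>A. [:1 - (p(i := p i + d, j := p j - d)) l,
        (p(i := p i + d, j := p j - d)) l:]) k)
      = (\<Sum>k<s. coeff (\<Prod>l\<in>A. [:1 - p l, p l:]) k) + ((p i + d) * (p j - d) - p i * p j) * C"
proof -
  define Q where "Q = (\<Prod>l\<in>A - {i} - {j}. [:1 - p l, p l:])"
  define C where "C = (\<Sum>k<s. coeff ([:1, -2, 1:] * Q) k)"
  have A: "finite (A - {i})" "j \<in> A - {i}" using assms by auto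
  have eq: "(\<Sum>k<s. coeff (\<Prod>l\<in>A. [:1 - q l, q l:]) k) =
      (\<Sum>k<s. coeff ([:1 - (p i + p j), p i + p j:] * Q) k) + q i * q j * C"
    if "q i + q j = p i + p j" "\<And>l. l \<in> A - {i} - {j} \<Longrightarrow> q l = p l" for q
  proof -
    have "(\<Prod>l\<in>A. [:1 - q l, q l:]) = [:1 - q i, q i:] * [:1 - q j, q j:] * (\<Prod>l\<in>A - {i} - {j}. [:1 - q l, q l:])"
      by (simp only: prod.remove[OF assms(1,2)] prod.remove[OF A] mult.assoc)
    also have "(\<Prod>l\<in>A - {i} - {j}. [:1 - q l, q l:]) = Q"
      unfolding Q_def using that(2) by (intro prod.cong) auto
    finally have "(\<Prod>l\<in>A. [:1 - q l, q l:]) =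
        [:1 - (p i + p j), p i + p j:] * Q + Polynomial.smult (q i * q j) ([:1, -2, 1:] * Q)"
      by (simp only: bernoulli_pair_poly that(1) distrib_right mult_smult_left)
    then show ?thesis
      by (simp only: C_def coeff_add coeff_smult sum.distrib sum_distrib_left)
  qed
  have "(\<Sum>k<s. coeff (\<Prod>l\<in>A. [:1 - (p(i := p i + d, j := p j - d)) l,
        (p(i := p i + d, j := p j - d)) l:]) k)
      = (\<Sum>k<s. coeff (\<Prod>l\<in>A. [:1 - p l, p l:]) k) + ((p i + d) * (p j - d) - p i * p j) * C" for d
    using eq[of p] eq[of "p(i := p i + d, j := p j - d)"] assms(4)
    by (simp add: left_diff_distrib)
  then show ?thesis by (rule that)
qed

text \<open>Two nested inductions. The outer one, on \<open>card A\<close>, disposes of values 0 and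
  1; the inner one, on the number of \<open>p i\<close> different from the mean \<open>c\<close>,
  ends in the binomial case where all are equal.\<close>

lemma poisson_binomial_head_le_half:
  fixes p :: "'b \<Rightarrow> real"
  assumes "finite A" and "\<And>j. j \<in> A \<Longrightarrow> 0 \<le> p j \<and> p j \<le> 1" and "sum p A = real s"
  shows "(\<Sum>k<s. coeff (\<Prod>j\<in>A. [:1 - p j, p j:]) k) \<le> 1 / 2"
  using assms
proof (induction "card A" arbitrary: A p s rule: less_induct)
  case less
  define n where "n = card A"
  define c where "c = real s / real n"
  \<comment> \<open>A factor with value 0 or 1 is the constant 1 or X. Removing it leaves an integer
    mean, so the outer induction hypothesis applies.\<close>
  have boundary: "(\<Sum>k<s. coeff (\<Prod>j\<in>A. [:1 - p j, p j:]) k) \<le> 1 / 2"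
    if p: "\<And>j. j \<in> A \<Longrightarrow> 0 \<le> p j \<and> p j \<le> 1" "sum p A = real s"
      and j: "j \<in> A" "p j = 0 \<or> p j = 1" for p j
  proof -
    define Q where "Q = (\<Prod>l\<in>A - {j}. [:1 - p l, p l:])"
    have IH: "(\<Sum>k<m. coeff Q k) \<le> 1 / 2" if "sum p (A - {j}) = real m" for m
      unfolding Q_def using less(2) j p that card_Diff1_less[of A j] by (intro less(1)) auto
    have P: "(\<Prod>l\<in>A. [:1 - p l, p l:]) = [:1 - p j, p j:] * Q"
      unfolding Q_def using less(2) j by (simp add: prod.remove)
    have sm: "sum p A = p j + sum p (A - {j})" using less(2) j by (simp add: sum.remove)
    from j(2) show ?thesis
    proof
      assume "p j = 0"
      then show ?thesis using IH[of s] sm p(2) P by simp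
    next
      \<comment> \<open>The factor X shifts all coefficients by one, so the length of the head drops
        by one together with the mean.\<close>
      assume j1: "p j = 1"
      have "0 \<le> sum p (A - {j})" using p by (intro sum_nonneg) auto
      then obtain m where m: "s = Suc m" using sm p(2) j1 by (cases s) auto
      then show ?thesis using IH[of m] sm p(2) P j1
        by (simp add: sum.lessThan_Suc_shift del: sum.lessThan_Suc)
    qed
  qed
  show ?case using less(3,4)
  proof (induction "card {i \<in> A. p i \<noteq> c}" arbitrary: p rule: less_induct)
    case (less p)
    note IH = less(1) and p = less(2,3)
    show ?case
    proof (cases "\<exists>j\<in>A. p j = 0 \<or> p j = 1")
      case True
      then show ?thesis using boundary p by blast
    next
      case nb: False
      have p01: "0 < p j" "p j < 1" if "j \<in> A" for j
        using p(1)[OF that] nb that by (force simp: less_le)+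
      show ?thesis
      proof (cases "\<forall>j\<in>A. p j = c")
        case True
        show ?thesis
        proof (cases "A = {}")
          case True then show ?thesis using p(2) by simp
        next
          case False
          then have "n > 0" using \<open>finite A\<close> by (simp add: n_def card_gt_0_iff)
          have "0 < c" "c < 1" using False True p01 by fastforce+
          then have s: "0 < s" "s < n" using \<open>n > 0\<close> by (auto simp: c_def zero_less_divide_iff)
          have "coeff (\<Prod>j\<in>A. [:1 - p j, p j:]) k = real (n choose k) * c ^ k * (1 - c) ^ (n - k)" for k
          proof -
            have "coeff (\<Prod>j\<in>A. [:1 - p j, p j:]) k
              = (\<Sum>I | I \<subseteq> A \<and> card I = k. c ^ k * (1 - c) ^ (n - k))"
              unfolding coeff_prod_linear[OF \<open>finite A\<close>]
            proof (intro sum.cong refl)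
              fix I assume "I \<in> {I. I \<subseteq> A \<and> card I = k}"
              then have I: "I \<subseteq> A" "card I = k" "card (A - I) = n - k"
                using \<open>finite A\<close> by (auto simp: n_def card_Diff_subset[OF finite_subset])
              have "(\<Prod>j\<in>I. p j) = (\<Prod>j\<in>I. c)" "(\<Prod>j\<in>A - I. 1 - p j) = (\<Prod>j\<in>A - I. 1 - c)"
                using True I(1) by (auto intro!: prod.cong simp del: prod_constant)
              then show "(\<Prod>j\<in>I. p j) * (\<Prod>j\<in>A - I. 1 - p j) = c ^ k * (1 - c) ^ (n - k)"
                using I by simp
            qed
            then show ?thesis by (simp add: n_subsets[OF \<open>finite A\<close>] n_def)
          qed
          then show ?thesis using binomial_head_le_half[OF s c_def] by simp
        qed
      next
        case False
        then have "n > 0" using \<open>finite A\<close> by (auto simp: n_def card_gt_0_iff)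
        then have sc: "sum p A = (\<Sum>j\<in>A. c)" using p(2) by (simp add: c_def n_def)
        obtain i where i: "i \<in> A" "p i < c"
        proof (rule ccontr)
          assume "\<not> thesis"
          then have "\<forall>i\<in>A. c \<le> p i" using that by force
          moreover obtain l where "l \<in> A" "p l \<noteq> c" using False by auto
          ultimately have "(\<Sum>j\<in>A. c) < sum p A"
            using \<open>finite A\<close> by (intro sum_strict_mono_ex1) (auto simp: less_le)
          then show False using sc by simp
        qed
        obtain j where j: "j \<in> A" "c < p j"
        proof (rule ccontr)
          assume "\<not> thesis"
          then have "\<forall>i\<in>A. p i \<le> c" using that by force
          then have "sum p A < (\<Sum>j\<in>A. c)"
            using \<open>finite A\<close> i by (intro sum_strict_mono_ex1) auto
          then show False using sc by simp
        qed
        have ij: "i \<noteq> j" using i j by auto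
        \<comment> \<open>Along \<open>q\<close> the head is an affine function of \<open>q d i * q d j\<close>. Depending on the sign of its
          slope, moving the two values together (until one equals \<open>c\<close>) or apart (until one
          reaches 0 or 1) does not decrease it.\<close>
        define q where "q d = p(i := p i + d, j := p j - d)" for d
        obtain C where C: "\<And>d. (\<Sum>k<s. coeff (\<Prod>l\<in>A. [:1 - q d l, q d l:]) k)
            = (\<Sum>k<s. coeff (\<Prod>l\<in>A. [:1 - p l, p l:]) k) + ((p i + d) * (p j - d) - p i * p j) * C"
          using head_shift_pair[OF \<open>finite A\<close> i(1) j(1) ij] unfolding q_def by blast
        have sq: "sum (q d) A = real s" for d
        proof -
          have split: "sum f A = f i + (f j + sum f (A - {i} - {j}))" for f :: "'b \<Rightarrow> real"
            using \<open>finite A\<close> i j ij sum.remove[of A i f] sum.remove[of "A - {i}" j f] by simp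
          then have "sum (q d) A = q d i + (q d j + sum (q d) (A - {i} - {j}))" .
          also have "sum (q d) (A - {i} - {j}) = sum p (A - {i} - {j})"
            by (intro sum.cong) (auto simp: q_def)
          also have "q d i + (q d j + \<dots>) = p i + (p j + sum p (A - {i} - {j}))"
            using ij by (simp add: q_def)
          also have "\<dots> = sum p A" by (rule split[symmetric])
          finally show ?thesis using p(2) by simp
        qed
        show ?thesis
        proof (cases "C \<ge> 0")
          case True
          define d where "d = min (c - p i) (p j - c)"
          have d: "0 < d" "d \<le> c - p i" "d \<le> p j - c" using i j by (auto simp: d_def)
          have bd: "0 \<le> q d l \<and> q d l \<le> 1" if "l \<in> A" for l
            using p01[OF that] p01[OF i(1)] p01[OF j(1)] d i j by (auto simp: q_def)
          have "q d i = c \<or> q d j = c" using ij by (auto simp: q_def d_def min_def)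
          moreover have "q d l = p l" if "l \<noteq> i" "l \<noteq> j" for l using that by (simp add: q_def)
          moreover have "p i \<noteq> c" "p j \<noteq> c" using i j by auto
          \<comment> \<open>Neither \<open>p i\<close> nor \<open>p j\<close> was equal to
            \<open>c\<close>, so the shift creates no new exception while removing at least
            one.\<close>
          ultimately have "{l \<in> A. q d l \<noteq> c} \<subset> {l \<in> A. p l \<noteq> c}"
            using i(1) j(1) by (smt (verit) mem_Collect_eq psubsetI subsetI)
          then have "card {l \<in> A. q d l \<noteq> c} < card {l \<in> A. p l \<noteq> c}"
            using \<open>finite A\<close> by (intro psubset_card_mono) auto
          then have "(\<Sum>k<s. coeff (\<Prod>l\<in>A. [:1 - q d l, q d l:]) k) \<le> 1 / 2"
            using IH bd sq by blast
          moreover have "(p i + d) * (p j - d) - p i * p j = d * (p j - p i - d)"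
            by (simp add: algebra_simps)
          then have "((p i + d) * (p j - d) - p i * p j) * C \<ge> 0"
            using d True by simp
          ultimately show ?thesis unfolding C by linarith
        next
          case False
          define d where "d = - min (p i) (1 - p j)"
          have d: "d < 0" "- d \<le> p i" "- d \<le> 1 - p j" using p01 i j by (auto simp: d_def)
          have bd: "0 \<le> q d l \<and> q d l \<le> 1" if "l \<in> A" for l
            using p01[OF that] p01[OF i(1)] p01[OF j(1)] d i j by (auto simp: q_def)
          have "q d i = 0 \<or> q d j = 1" using ij by (auto simp: q_def d_def min_def)
          then have "(\<Sum>k<s. coeff (\<Prod>l\<in>A. [:1 - q d l, q d l:]) k) \<le> 1 / 2"
            using boundary[OF bd sq] i j by blast
          moreover have "(p i + d) * (p j - d) - p i * p j = d * (p j - p i - d)"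
            by (simp add: algebra_simps)
          \<comment> \<open>Here \<open>d < 0\<close> and \<open>p i < p j\<close>, so the product
            falls, while the slope \<open>C\<close> is negative.\<close>
          then have "((p i + d) * (p j - d) - p i * p j) * C \<ge> 0"
            using d False i j by (simp add: mult_nonpos_nonpos mult_nonpos_nonneg)
          ultimately show ?thesis unfolding C by linarith
        qed
      qed
    qed
  qed
qed

section \<open>Tilted coefficients: rejective against independent sampling\<close>

text \<open>Both sides are the value of the polynomial at 1, since its degree is at most
  \<open>card A\<close>.\<close>

lemma sum_coeff_prod_linear:
  fixes a b :: "'b \<Rightarrow> real"
  assumes "finite A"
  shows "(\<Sum>k\<le>card A. coeff (\<Prod>j\<in>A. [:a j, b j:]) k) = (\<Prod>j\<in>A. a j + b j)"
proof -
  let ?R = "\<Prod>j\<in>A. [:a j, b j:]"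
  have "degree ?R \<le> (\<Sum>j\<in>A. 1)"
    using degree_prod_sum_le[OF assms, of "\<lambda>j. [:a j, b j:]"]
    by (rule order_trans) (intro sum_mono, auto)
  then have "(\<Sum>k\<le>card A. coeff ?R k) = (\<Sum>k\<le>degree ?R. coeff ?R k)"
    by (intro sum.mono_neutral_right) (auto simp: coeff_eq_0)
  also have "\<dots> = poly ?R 1" by (simp add: poly_altdef)
  also have "\<dots> = (\<Prod>j\<in>A. a j + b j)" by (simp add: poly_prod)
  finally show ?thesis .
qed

lemma coeff_tilted_le:
  fixes p x :: "'b \<Rightarrow> real"
  assumes A: "finite A" and p: "\<And>j. j \<in> A \<Longrightarrow> 0 \<le> p j \<and> p j \<le> 1" and s: "sum p A = real s"
    and x: "\<And>j. j \<in> A \<Longrightarrow> 1 \<le> x j"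
    and pos: "coeff (\<Prod>j\<in>A. [:1 - p j, p j:]) s > 0"
  shows "coeff (\<Prod>j\<in>A. [:1 - p j, p j * x j:]) s
    \<le> 2 * coeff (\<Prod>j\<in>A. [:1 - p j, p j:]) s * (\<Prod>j\<in>A. 1 + p j * (x j - 1))"
proof -
  define r where "r = coeff (\<Prod>j\<in>A. [:1 - p j, p j:])"
  define t where "t = coeff (\<Prod>j\<in>A. [:1 - p j, p j * x j:])"
  \<comment> \<open>Because \<open>1 \<le> x j\<close>, tilting raises every linear coefficient, as
    \<open>coeff_ratio_mono\<close> requires.\<close>
  have mono: "p j \<le> p j * x j" if "j \<in> A" for j
    using mult_left_mono[of 1 "x j" "p j"] p x that by simp
  have ratio: "t s > 0 \<and> r k / r s \<le> t k / t s" if "s \<le> k" for k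
    unfolding r_def t_def using p x mono pos that
    by (intro coeff_ratio_mono[OF A]) auto
  have tn: "0 \<le> t k" for k
    unfolding t_def coeff_prod_linear[OF A] using p x
    by (intro sum_nonneg mult_nonneg_nonneg prod_nonneg) force+
  have "real s \<le> (\<Sum>j\<in>A. 1)" unfolding s[symmetric] using p by (intro sum_mono) auto
  then have sA: "s \<le> card A" by simp
  then have split: "{..card A} = {..<s} \<union> {s..card A}" by auto
  have "(\<Sum>k<s. r k) + (\<Sum>k=s..card A. r k) = (\<Sum>k\<le>card A. r k)"
    unfolding split by (intro sum.union_disjoint[symmetric]) auto
  also have "\<dots> = 1" unfolding r_def by (simp add: sum_coeff_prod_linear[OF A])
  \<comment> \<open>The coefficients \<open>r k\<close> sum to 1 and the head takes at most half;
    the factor 2 of the bound comes from here.\<close>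
  finally have "1 / 2 \<le> (\<Sum>k=s..card A. r k)"
    using poisson_binomial_head_le_half[OF A p s] by (simp add: r_def)
  then have "1 / 2 / r s \<le> (\<Sum>k=s..card A. r k) / r s"
    using pos by (intro divide_right_mono) (auto simp: r_def)
  also have "\<dots> \<le> (\<Sum>k=s..card A. t k / t s)"
    unfolding sum_divide_distrib using ratio by (intro sum_mono) auto
  also have "\<dots> \<le> (\<Sum>k\<le>card A. t k) / t s"
    unfolding sum_divide_distrib using tn by (intro sum_mono2) auto
  also have "\<dots> = (\<Prod>j\<in>A. 1 + p j * (x j - 1)) / t s"
    unfolding t_def by (simp add: sum_coeff_prod_linear[OF A] algebra_simps)
  finally show ?thesis
    using pos ratio[of s] by (simp add: r_def t_def field_simps)
qed

section \<open>The Chernoff bound for rejective sampling\<close>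

text \<open>\<open>y powr w\<close> is convex in \<open>w\<close>, hence on [0, 1] below its chord
  from 1 to \<open>y\<close>.\<close>

lemma powr_le_chord:
  fixes y w :: real
  assumes "0 < y" "0 \<le> w" "w \<le> 1"
  shows "y powr w \<le> 1 + w * (y - 1)"
  using convex_onD[OF exp_convex, of w 0 "ln y"] assms by (simp add: powr_def algebra_simps)

lemma set_pmf_rejective_sampling:
  assumes "\<And>i. i < K \<Longrightarrow> 0 \<le> p i \<and> p i \<le> 1" "(\<Sum>i<K. p i) = real S"
  shows "set_pmf (rejective_sampling K S p) \<subseteq> {I. I \<subseteq> {..<K} \<and> card I = S}"
proof -
  have "set_pmf (rejective_sampling K S p) = set_pmf (poisson_sampling K p) \<inter> {I. card I = S}"
    unfolding rejective_sampling_def by (rule set_cond_pmf[OF rejective_sampling_well_defined[OF assms]])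
  then show ?thesis by (auto simp: poisson_sampling_def)
qed

text \<open>Markov's inequality for the product of the \<open>x i\<close>: its expectation is a
  tilted coefficient divided by \<open>Z\<close>, the Poisson probability of
  \<open>card I = S\<close>, and \<open>coeff_tilted_le\<close> bounds this by twice the value under
  independent sampling.\<close>

lemma rejective_sampling_tilted_Markov:
  fixes x :: "nat \<Rightarrow> real"
  assumes p: "\<And>i. i < K \<Longrightarrow> 0 \<le> p i \<and> p i \<le> 1" and s: "(\<Sum>i<K. p i) = real S"
    and x: "\<And>i. i < K \<Longrightarrow> 1 \<le> x i" and c: "c > 0"
  shows "measure_pmf.prob (rejective_sampling K S p) {I. c \<le> (\<Prod>i\<in>I. x i)}
    \<le> 2 / c * (\<Prod>i<K. 1 + p i * (x i - 1))"
proof -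
  define \<Omega> where "\<Omega> = {I. I \<subseteq> {..<K} \<and> card I = S}"
  define F where "F = {I. c \<le> (\<Prod>i\<in>I. x i)}"
  define P where "P I = (\<Prod>i\<in>I. p i) * (\<Prod>j\<in>{..<K} - I. 1 - p j)" for I
  define Z where "Z = coeff (\<Prod>j<K. [:1 - p j, p j:]) S"
  have fin: "finite \<Omega>" unfolding \<Omega>_def by (rule finite_subset[of _ "Pow {..<K}"]) auto
  have ne: "set_pmf (poisson_sampling K p) \<inter> {I. card I = S} \<noteq> {}"
    by (rule rejective_sampling_well_defined[OF p s])
  have sub: "set_pmf (poisson_sampling K p) \<subseteq> Pow {..<K}"
    by (auto simp: poisson_sampling_def)
  have P: "pmf (poisson_sampling K p) I = P I" if "I \<in> \<Omega>" for I
    unfolding P_def using that by (intro pmf_poisson_sampling[OF p]) (auto simp: \<Omega>_def)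
  have "measure_pmf.prob (poisson_sampling K p) {I. card I = S} = measure_pmf.prob (poisson_sampling K p) \<Omega>"
    using sub by (intro measure_prob_cong_0) (auto simp: \<Omega>_def set_pmf_iff)
  also have "\<dots> = (\<Sum>I\<in>\<Omega>. P I)" using P by (simp add: measure_measure_pmf_finite[OF fin])
  also have "\<dots> = Z" by (simp add: Z_def coeff_prod_linear \<Omega>_def P_def)
  finally have Z: "measure_pmf.prob (poisson_sampling K p) {I. card I = S} = Z" .
  obtain J where "J \<in> set_pmf (poisson_sampling K p)" "J \<in> {I. card I = S}" using ne by blast
  then have Zpos: "Z > 0" unfolding Z[symmetric] by (rule measure_pmf_posI)
  have P0: "0 \<le> P I" if "I \<in> \<Omega>" for I using P[OF that] pmf_nonneg by metis
  have x0: "0 \<le> (\<Prod>i\<in>I. x i)" if "I \<in> \<Omega>" for I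
    using that x by (intro prod_nonneg) (force simp: \<Omega>_def)
  have "measure_pmf.prob (rejective_sampling K S p) F = measure_pmf.prob (rejective_sampling K S p) (F \<inter> \<Omega>)"
    using set_pmf_rejective_sampling[OF p s]
    by (intro measure_prob_cong_0) (auto simp: \<Omega>_def set_pmf_iff)
  also have "\<dots> = (\<Sum>I\<in>F \<inter> \<Omega>. pmf (rejective_sampling K S p) I)"
    using fin by (intro measure_measure_pmf_finite) auto
  also have "\<dots> = (\<Sum>I\<in>F \<inter> \<Omega>. P I / Z)"
  proof (intro sum.cong refl)
    fix I assume "I \<in> F \<inter> \<Omega>"
    then have "I \<in> {I. card I = S}" "I \<in> \<Omega>" by (auto simp: \<Omega>_def)
    then show "pmf (rejective_sampling K S p) I = P I / Z"
      unfolding rejective_sampling_def pmf_cond[OF ne] by (simp only: if_True P Z)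
  qed
  \<comment> \<open>On \<open>F\<close> the inserted factor is at least 1.\<close>
  also have "\<dots> \<le> (\<Sum>I\<in>F \<inter> \<Omega>. ((\<Prod>i\<in>I. x i) / c) * (P I / Z))"
  proof (intro sum_mono)
    fix I assume I: "I \<in> F \<inter> \<Omega>"
    have "1 * (P I / Z) \<le> ((\<Prod>i\<in>I. x i) / c) * (P I / Z)"
      using I c P0 Zpos by (intro mult_right_mono) (auto simp: F_def)
    then show "P I / Z \<le> ((\<Prod>i\<in>I. x i) / c) * (P I / Z)" by simp
  qed
  also have "\<dots> \<le> (\<Sum>I\<in>\<Omega>. ((\<Prod>i\<in>I. x i) / c) * (P I / Z))"
    using fin c P0 Zpos x0 by (intro sum_mono2) auto
  also have "\<dots> = (\<Sum>I\<in>\<Omega>. (\<Prod>i\<in>I. x i) * P I) / (c * Z)"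
    by (simp add: sum_divide_distrib)
  also have "(\<Sum>I\<in>\<Omega>. (\<Prod>i\<in>I. x i) * P I) = coeff (\<Prod>j<K. [:1 - p j, p j * x j:]) S"
    by (simp add: coeff_prod_linear \<Omega>_def P_def prod.distrib mult_ac)
  also have "\<dots> / (c * Z) \<le> 2 * Z * (\<Prod>i<K. 1 + p i * (x i - 1)) / (c * Z)"
    using Zpos c coeff_tilted_le[of "{..<K}" p S x] p s x
    by (intro divide_right_mono) (auto simp: Z_def)
  finally show ?thesis using Zpos by (simp add: F_def)
qed

lemma rejective_sampling_exponential_tail:
  fixes w :: "nat \<Rightarrow> real"
  assumes p: "\<And>i. i < K \<Longrightarrow> 0 \<le> p i \<and> p i \<le> 1" and s: "(\<Sum>i<K. p i) = real S"
    and w: "\<And>i. i < K \<Longrightarrow> 0 \<le> w i \<and> w i \<le> 1" and y: "1 \<le> y"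
  shows "measure_pmf.prob (rejective_sampling K S p) {I. a \<le> (\<Sum>i\<in>I. w i)}
    \<le> 2 * y powr (- a) * exp ((\<Sum>i<K. p i * w i) * (y - 1))"
proof -
  \<comment> \<open>The chord value replaces \<open>y powr w i\<close>: it is at least as large, and
    it makes \<open>p i * (x i - 1)\<close> linear in \<open>w i\<close>, so only the weighted sum
    survives in the exponent.\<close>
  define x where "x i = 1 + w i * (y - 1)" for i
  have x: "1 \<le> x i" if "i < K" for i using w[OF that] y by (simp add: x_def)
  have y0: "y > 0" using y by simp
  have "measure_pmf.prob (rejective_sampling K S p) {I. a \<le> (\<Sum>i\<in>I. w i)}
      \<le> measure_pmf.prob (rejective_sampling K S p) {I. y powr a \<le> (\<Prod>i\<in>I. x i)}"
  proof (rule measure_pmf.finite_measure_mono_AE)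
    have "y powr a \<le> (\<Prod>i\<in>I. x i)" if "I \<subseteq> {..<K}" "a \<le> (\<Sum>i\<in>I. w i)" for I
    proof -
      have "y powr a \<le> y powr (\<Sum>i\<in>I. w i)" using that y by (intro powr_mono) auto
      also have "\<dots> = (\<Prod>i\<in>I. y powr w i)"
        using y0 that(1) finite_subset by (subst powr_sum) auto
      also have "\<dots> \<le> (\<Prod>i\<in>I. x i)"
        using that(1) w y0 by (intro prod_mono) (auto simp: x_def intro!: powr_le_chord)
      finally show ?thesis .
    qed
    then show "AE I in rejective_sampling K S p.
        I \<in> {I. a \<le> (\<Sum>i\<in>I. w i)} \<longrightarrow> I \<in> {I. y powr a \<le> (\<Prod>i\<in>I. x i)}"
      using set_pmf_rejective_sampling[OF p s] by (auto simp: AE_measure_pmf_iff)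
  qed simp
  also have "\<dots> \<le> 2 / y powr a * (\<Prod>i<K. 1 + p i * (x i - 1))"
    using p s x y0 by (intro rejective_sampling_tilted_Markov) auto
  also have "(\<Prod>i<K. 1 + p i * (x i - 1)) \<le> (\<Prod>i<K. exp (p i * (x i - 1)))"
    using p x by (intro prod_mono) (auto simp: exp_ge_add_one_self add_nonneg_nonneg)
  also have "\<dots> = exp ((\<Sum>i<K. p i * w i) * (y - 1))"
    by (simp add: x_def exp_sum sum_distrib_right mult.assoc)
  finally show ?thesis using y0
    by (simp add: powr_minus divide_inverse mult_left_mono)
qed

text \<open>With \<open>m\<close> the weighted sum, the exponential tail bound is smallest at
  \<open>y = a / m\<close>, which is admissible when \<open>0 < m < a\<close>. If
  \<open>a \<le> m\<close>, the claimed bound exceeds 1.\<close>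

lemma rejective_sampling_Chernoff:
  fixes w :: "nat \<Rightarrow> real"
  assumes p: "\<And>i. i < K \<Longrightarrow> 0 \<le> p i \<and> p i \<le> 1" and s: "(\<Sum>i<K. p i) = real S"
    and w: "\<And>i. i < K \<Longrightarrow> 0 \<le> w i \<and> w i \<le> 1" and a: "0 < a"
  shows "measure_pmf.prob (rejective_sampling K S p) {I. a \<le> (\<Sum>i\<in>I. w i)}
    \<le> 2 * (exp 1 * ((\<Sum>i<K. p i * w i) / a)) powr a" (is "?L \<le> _")
proof -
  define m where "m = (\<Sum>i<K. p i * w i)"
  have tail: "?L \<le> 2 * y powr (- a) * exp (m * (y - 1))" if "1 \<le> y" for y
    unfolding m_def by (rule rejective_sampling_exponential_tail[OF p s w that])
  have "0 \<le> m" unfolding m_def using p w by (intro sum_nonneg) auto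
  then consider "m = 0" | "0 < m" "m < a" | "a \<le> m" by fastforce
  then show ?thesis
  proof cases
    case 1
    \<comment> \<open>For \<open>m = 0\<close> no finite \<open>y\<close> is optimal. The bound to
      be reached is 0, as \<open>0 powr a = 0\<close>, so \<open>y\<close> tends to
      infinity.\<close>
    have "((\<lambda>y. 2 * y powr (- a)) \<longlongrightarrow> 2 * 0) at_top"
      using a by (intro tendsto_intros tendsto_neg_powr filterlim_ident) auto
    moreover have "eventually (\<lambda>y. ?L \<le> 2 * y powr (- a)) at_top"
      using eventually_ge_at_top[of 1] by eventually_elim (use tail 1 in force)
    ultimately have "?L \<le> 0" using tendsto_lowerbound by fastforce
    then show ?thesis using 1 by (simp add: m_def)
  next
    case 2
    have "?L \<le> 2 * (a / m) powr (- a) * exp (m * (a / m - 1))" using 2 by (intro tail) simp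
    also have "(a / m) powr (- a) = (m / a) powr a"
      using 2 by (simp add: powr_minus powr_divide)
    \<comment> \<open>The exponent equals \<open>a - m\<close>; the helpful \<open>- m\<close> is
      dropped.\<close>
    also have "exp (m * (a / m - 1)) \<le> exp 1 powr a"
      using 2 by (simp add: powr_def algebra_simps)
    finally show ?thesis
      using 2 powr_mult[of "exp 1" "m / a" a] by (simp add: m_def mult_ac)
  next
    case 3
    have "1 * 1 \<le> exp 1 * (m / a)" using a 3 by (intro mult_mono) auto
    then have "1 \<le> (exp 1 * (m / a)) powr a" using a by (intro ge_one_powr_ge_zero) auto
    moreover have "?L \<le> 1" by (rule measure_pmf.prob_le_1)
    ultimately have "?L \<le> 2 * (exp 1 * (m / a)) powr a" by linarith
    then show ?thesis unfolding m_def .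
  qed
qed

section \<open>Row norms of the column submatrix and of the weighted matrix\<close>

lemma vec_l2_norm_row_column_submatrix:
  assumes H: "H \<in> carrier_mat m n" and I: "I \<subseteq> {..<n}" and i: "i < m"
  shows "(vec_l2_norm (Matrix.row (column_submatrix H I) i))\<^sup>2 = (\<Sum>j\<in>I. (H $$ (i, j))\<^sup>2)"
proof -
  have I': "{j. j < n \<and> j \<in> I} = I" using I by auto
  have fin: "finite I" using I finite_subset by auto
  have "(vec_l2_norm (Matrix.row (column_submatrix H I) i))\<^sup>2
      = (\<Sum>j<card I. (H $$ (i, pick I j))\<^sup>2)"
    using H i by (simp add: vec_l2_norm_def column_submatrix_def L2_set_def sum_nonneg
        submatrix_def I' pick_UNIV)
  \<comment> \<open>\<open>pick I\<close> enumerates \<open>I\<close> increasingly from index 0; its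
    inverse sends an element to its rank.\<close>
  also have "\<dots> = (\<Sum>j\<in>I. (H $$ (i, j))\<^sup>2)"
    using fin
    by (intro sum.reindex_bij_witness[of _ "\<lambda>j. card {a \<in> I. a < j}" "pick I"])
      (auto simp: card_pick pick_card_in_set pick_in_set intro!: psubset_card_mono)
  finally show ?thesis .
qed

text \<open>For nonempty \<open>I\<close> the norm is the largest row norm, so one row must reach
  \<open>v\<close>. For empty \<open>I\<close> there are no unit vectors and the supremum would
  range over the empty set.\<close>

lemma norm_inf_2_column_submatrix_ge_iff:
  assumes H: "H \<in> carrier_mat m n" and I: "I \<subseteq> {..<n}" "I \<noteq> {}" and "0 < m" "0 < v"
  shows "v \<le> norm_inf_2 (column_submatrix H I) \<longleftrightarrow> (\<exists>i<m. v\<^sup>2 \<le> (\<Sum>j\<in>I. (H $$ (i, j))\<^sup>2))"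
proof -
  have I': "{j. j < dim_col H \<and> j \<in> I} = I" using H I by auto
  have "finite I" using I finite_subset by auto
  then have dims: "dim_row (column_submatrix H I) = m" "dim_col (column_submatrix H I) > 0"
    using H I by (auto simp: column_submatrix_def dim_submatrix I' card_gt_0_iff)
  have "v \<le> vec_l2_norm r \<longleftrightarrow> v\<^sup>2 \<le> (vec_l2_norm r)\<^sup>2" for r
    using \<open>0 < v\<close> abs_le_square_iff[of v "vec_l2_norm r"] by (simp add: vec_l2_norm_def L2_set_nonneg)
  moreover have "norm_inf_2 (column_submatrix H I)
      = Max ((\<lambda>i. vec_l2_norm (Matrix.row (column_submatrix H I) i)) ` {..<m})"
    using dims \<open>0 < m\<close> norm_inf_2_eq_Max_row[of "column_submatrix H I"] by simp
  ultimately show ?thesis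
    using \<open>0 < m\<close> vec_l2_norm_row_column_submatrix[OF H I(1)]
    by (simp add: Max_ge_iff lessThan_empty_iff Bex_def)
qed

text \<open>The left side is the squared norm of row \<open>i\<close> of the weighted matrix, and
  also the mean squared norm of row \<open>i\<close> of the column submatrix under Poisson sampling;
  this links the Chernoff bound to the weight matrix.\<close>

lemma row_sum_squares_le_norm_inf_2:
  assumes H: "H \<in> carrier_mat K K" and p: "\<And>j. j < K \<Longrightarrow> 0 \<le> p j" and i: "i < K"
  shows "(\<Sum>j<K. p j * (H $$ (i, j))\<^sup>2) \<le> (norm_inf_2 (H * weight_matrix K p))\<^sup>2"
proof -
  let ?A = "H * weight_matrix K p"
  have dims: "dim_row ?A = K" "dim_col ?A = K" using H by (auto simp: weight_matrix_def)
  have entry: "?A $$ (i, j) = H $$ (i, j) * sqrt (p j)" if "j < K" for j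
  proof -
    have "?A $$ (i, j) = (\<Sum>l<K. H $$ (i, l) * (if l = j then sqrt (p l) else 0))"
      using H i that by (auto simp: weight_matrix_def scalar_prod_def atLeast0LessThan intro!: sum.cong)
    also have "\<dots> = (\<Sum>l<K. if l = j then H $$ (i, l) * sqrt (p l) else 0)"
      by (intro sum.cong) auto
    finally show ?thesis using that by simp
  qed
  have "(\<Sum>j<K. p j * (H $$ (i, j))\<^sup>2) = (\<Sum>j<K. (?A $$ (i, j))\<^sup>2)"
    using p entry by (intro sum.cong) (auto simp: power_mult_distrib)
  also have "\<dots> = (vec_l2_norm (Matrix.row ?A i))\<^sup>2"
    using dims i by (simp add: vec_l2_norm_def L2_set_def sum_nonneg)
  also have "\<dots> \<le> (norm_inf_2 ?A)\<^sup>2"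
  proof (intro power_mono)
    show "vec_l2_norm (Matrix.row ?A i) \<le> norm_inf_2 ?A"
      using dims i by (subst norm_inf_2_eq_Max_row) auto
  qed (simp add: vec_l2_norm_def L2_set_nonneg)
  finally show ?thesis .
qed

section \<open>Union bound over the rows\<close>

theorem lemma6:
  fixes K S :: nat and H W :: "real Matrix.mat" and p :: "nat \<Rightarrow> real" and \<mu> v :: real
  assumes H: "H \<in> carrier_mat K K"
    and mu: "\<mu> = max_abs_entry H"
    and p: "\<And>i. i < K \<Longrightarrow> 0 \<le> p i \<and> p i \<le> 1"
    and S_pos: "S > 0"
    and sum_p: "(\<Sum>i<K. p i) = real S"
    and W: "W = weight_matrix K p"
    and v: "v > 0"
  shows "measure_pmf.prob (rejective_sampling K S p) {I. norm_inf_2 (column_submatrix H I) \<ge> v}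
           \<le> 2 * real K * (exp 1 * ((norm_inf_2 (H * W))\<^sup>2 / v\<^sup>2)) powr (v\<^sup>2 / \<mu>\<^sup>2)"
proof -
  let ?M = "rejective_sampling K S p"
  have K: "K > 0" using sum_p S_pos by (cases K) auto
  define E where "E i = {I. v\<^sup>2 \<le> (\<Sum>j\<in>I. (H $$ (i, j))\<^sup>2)}" for i
  define B where "B = (exp 1 * ((norm_inf_2 (H * W))\<^sup>2 / v\<^sup>2)) powr (v\<^sup>2 / \<mu>\<^sup>2)"
  have entry: "\<bar>H $$ (i, j)\<bar> \<le> \<mu>" if "i < K" "j < K" for i j
  proof -
    have "finite (elements_mat H)" by (simp add: elements_mat_def)
    moreover have "H $$ (i, j) \<in> elements_mat H" using H that by (intro elements_matI) auto
    ultimately show ?thesis unfolding mu max_abs_entry_def by (intro Max_ge) auto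
  qed
  have row: "measure_pmf.prob ?M (E i) \<le> 2 * B" if i: "i < K" for i
  \<comment> \<open>The weights \<open>w\<close> below divide by \<open>\<mu>\<^sup>2\<close>. If
    \<open>\<mu> = 0\<close>, all entries vanish and the event has probability 0.\<close>
  proof (cases "\<mu> = 0")
    case True
    have "measure_pmf.prob ?M (E i) = 0"
    proof (subst measure_pmf_zero_iff, rule ccontr)
      assume "set_pmf ?M \<inter> E i \<noteq> {}"
      then obtain I where "I \<in> set_pmf ?M" and EI: "I \<in> E i" by blast
      then have I: "I \<subseteq> {..<K}" using set_pmf_rejective_sampling[OF p sum_p] by blast
      have "(\<Sum>j\<in>I. (H $$ (i, j))\<^sup>2) = 0"
        using entry[OF i] True I by (intro sum.neutral) force
      then show False using v EI by (simp add: E_def)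
    qed
    then show ?thesis by (simp add: B_def)
  next
    case False
    \<comment> \<open>This scaling brings the weights into [0, 1] and turns the threshold
      \<open>v\<^sup>2\<close> into the exponent of the claim.\<close>
    define w where "w j = (H $$ (i, j))\<^sup>2 / \<mu>\<^sup>2" for j
    have w: "0 \<le> w j \<and> w j \<le> 1" if "j < K" for j
      using entry[OF i that] False abs_le_square_iff[of "H $$ (i, j)" \<mu>] by (simp add: w_def)
    have "E i = {I. v\<^sup>2 / \<mu>\<^sup>2 \<le> (\<Sum>j\<in>I. w j)}"
      using False by (auto simp: E_def w_def divide_le_cancel simp flip: sum_divide_distrib)
    then have "measure_pmf.prob ?M (E i)
        \<le> 2 * (exp 1 * ((\<Sum>j<K. p j * w j) / (v\<^sup>2 / \<mu>\<^sup>2))) powr (v\<^sup>2 / \<mu>\<^sup>2)"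
      using rejective_sampling_Chernoff[OF p sum_p w, where a = "v\<^sup>2 / \<mu>\<^sup>2"] v False by simp
    also have "(\<Sum>j<K. p j * w j) / (v\<^sup>2 / \<mu>\<^sup>2) = (\<Sum>j<K. p j * (H $$ (i, j))\<^sup>2) / v\<^sup>2"
      using False by (simp add: w_def flip: sum_divide_distrib)
    also have "2 * (exp 1 * \<dots>) powr (v\<^sup>2 / \<mu>\<^sup>2) \<le> 2 * B"
      unfolding B_def W using p row_sum_squares_le_norm_inf_2[OF H _ i, of p]
      by (intro mult_left_mono powr_mono2 divide_right_mono) (auto intro!: mult_nonneg_nonneg divide_nonneg_nonneg sum_nonneg)
    finally show ?thesis .
  qed
  have "measure_pmf.prob ?M {I. norm_inf_2 (column_submatrix H I) \<ge> v} \<le> measure_pmf.prob ?M (\<Union>i<K. E i)"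
  proof (rule measure_pmf.finite_measure_mono_AE)
    show "AE I in ?M. I \<in> {I. norm_inf_2 (column_submatrix H I) \<ge> v} \<longrightarrow> I \<in> (\<Union>i<K. E i)"
      unfolding AE_measure_pmf_iff
    proof (intro ballI impI)
      fix I assume "I \<in> set_pmf ?M" and I: "I \<in> {I. norm_inf_2 (column_submatrix H I) \<ge> v}"
      then have "I \<subseteq> {..<K}" "I \<noteq> {}"
        using set_pmf_rejective_sampling[OF p sum_p] S_pos by auto
      then show "I \<in> (\<Union>i<K. E i)"
        using I norm_inf_2_column_submatrix_ge_iff[OF H _ _ K v] by (auto simp: E_def)
    qed
  qed simp
  also have "\<dots> \<le> (\<Sum>i<K. measure_pmf.prob ?M (E i))"
    by (intro measure_pmf.finite_measure_subadditive_finite) auto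
  also have "\<dots> \<le> (\<Sum>i<K. 2 * B)" using row by (intro sum_mono) auto
  finally show ?thesis by (simp add: B_def mult_ac)
qed

end
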